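(* Let $G$ be a finite group and $N$ a normal subgroup of $G$. Assume that $N$ satisfies property (P) and that $G/N$ admits a complete mapping. Then $G$ satisfies property (P).
   Context: A complete mapping of a group $G$ is a permutation $f$ of the set $G$ such that $g\mapsto gf(g)$ is also a permutation of $G$. A finite group satisfies property (P) if it admits both a complete mapping that is an even permutation of the group's underlying set and a complete mapping that is an odd permutation of it. *)

theory Defs
  imports "HOL-Algebra.Coset" "HOL-Combinatorics.Permutations"
begin

definition complete_mapping :: "('a, 'b) monoid_scheme \<Rightarrow> ('a \<Rightarrow> 'a) \<Rightarrow> bool" where
  "complete_mapping G f \<longleftrightarrow>
     f permutes carrier G \<and>
     bij_betw (\<lambda>g. g \<otimes>\<^bsub>G\<^esub> f g) (carrier G) (carrier G)"

text \<open>
  A function that permutes \<open>carrier G\<close> is the identity outside it, so on a finite carrier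
  \<^const>\<open>evenperm\<close> is the parity of the permutation of \<open>carrier G\<close>. On an infinite carrier
  \<^const>\<open>evenperm\<close> carries no meaning for permutations of infinite support; the property is
  intended for finite groups only.
\<close>

definition property_P :: "('a, 'b) monoid_scheme \<Rightarrow> bool" where
  "property_P G \<longleftrightarrow>
     (\<exists>f. complete_mapping G f \<and> evenperm f) \<and>
     (\<exists>f. complete_mapping G f \<and> \<not> evenperm f)"

end

theory Submission
  imports Defs
begin

text \<open>
  Choose a representative \<open>t C\<close> of every coset \<open>C\<close> of \<open>N\<close>, let \<open>\<phi>\<close> be a complete mapping of \<open>G/N\<close>,
  and choose independently for every coset \<open>C\<close> a complete mapping \<open>h C\<close> of \<open>N\<close>. Normality lets every
  element of \<open>C\<close> be written as \<open>t C \<otimes> n\<close> with \<open>n \<in> N\<close>, and the map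
  \<open>F: t C \<otimes> n \<mapsto> h C n \<otimes> t (\<phi> C)\<close> is a complete mapping of \<open>G\<close>. Indeed, \<open>F\<close> maps \<open>C\<close> bijectively
  onto \<open>\<phi> C\<close>; and the representatives are placed on the outer sides so that
  \<open>(t C \<otimes> n) \<otimes> F (t C \<otimes> n) = t C \<otimes> (n \<otimes> h C n) \<otimes> t (\<phi> C)\<close>, which runs through the coset product
  \<open>C \<phi>(C)\<close> exactly once as \<open>n\<close> runs through \<open>N\<close>. Both \<open>\<phi>\<close> and \<open>C \<mapsto> C \<phi>(C)\<close> permute the cosets, so
  the pieces fit together (lemma \<open>complete_mapping_coset_lift\<close>).

  Now change \<open>h\<close> at a single coset, from an even to an odd complete mapping of \<open>N\<close>. This
  composes \<open>F\<close> with a copy, living on that coset, of an odd permutation of \<open>N\<close>, so the parity of \<open>F\<close>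
  flips (lemma \<open>evenperm_coset_lift_upd\<close>). One of the two resulting complete mappings is thus even
  and the other is odd.
\<close>

text \<open>The map \<open>F\<close>, written in terms of \<open>x = t C \<otimes> n\<close>, so that \<open>n\<close> is \<open>inv (t C) \<otimes> x\<close>.\<close>

definition (in normal) coset_lift ::
    "('a set \<Rightarrow> 'a) \<Rightarrow> ('a set \<Rightarrow> 'a set) \<Rightarrow> ('a set \<Rightarrow> 'a \<Rightarrow> 'a) \<Rightarrow> 'a \<Rightarrow> 'a" where
  "coset_lift t \<phi> h x =
     (if x \<in> carrier G
      then h (H #> x) (inv (t (H #> x)) \<otimes> x) \<otimes> t (\<phi> (H #> x))
      else x)"

context normal
begin

lemma bij_betw_carrier_if_bij_betw_rcosets:
  assumes \<psi>: "bij_betw \<psi> (rcosets H) (rcosets H)"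
    and F: "\<And>C. C \<in> rcosets H \<Longrightarrow> bij_betw F C (\<psi> C)"
  shows "bij_betw F (carrier G) (carrier G)"
proof -
  have "disjoint_family_on \<psi> (rcosets H)"
    unfolding disjoint_family_on_def
  proof (intro ballI impI)
    fix C D assume CD: "C \<in> rcosets H" "D \<in> rcosets H" "C \<noteq> D"
    then have "\<psi> C \<in> rcosets H" "\<psi> D \<in> rcosets H" "\<psi> C \<noteq> \<psi> D"
      using bij_betw_apply[OF \<psi>] inj_on_eq_iff[OF bij_betw_imp_inj_on[OF \<psi>]] by simp_all
    then show "\<psi> C \<inter> \<psi> D = {}"
      using pairwiseD[OF rcos_disjoint[OF is_subgroup]] by (simp add: disjnt_def)
  qed
  then have "bij_betw F (\<Union>C\<in>rcosets H. C) (\<Union>C\<in>rcosets H. \<psi> C)"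
    using F by (rule bij_betw_UNION_disjoint)
  moreover have "(\<Union>C\<in>rcosets H. \<psi> C) = \<Union>(rcosets H)"
    using \<psi> by (simp add: bij_betw_def)
  ultimately show ?thesis
    by (simp add: rcosets_part_G[OF is_subgroup])
qed

lemma bij_betw_r_coset:
  assumes "r \<in> carrier G"
  shows "bij_betw (\<lambda>n. n \<otimes> r) H (H #> r)"
  using assms mem_carrier by (auto simp: bij_betw_def inj_on_def r_coset_def)

lemma bij_betw_l_coset:
  assumes "r \<in> carrier G" "A \<subseteq> carrier G"
  shows "bij_betw (\<lambda>x. r \<otimes> x) A (r <# A)"
  using assms by (auto simp: bij_betw_def inj_on_def l_coset_def subset_iff)

lemma bij_betw_rep_l_mult:
  assumes "r \<in> carrier G"
  shows "bij_betw (\<lambda>n. r \<otimes> n) H (H #> r)"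
  using bij_betw_l_coset[OF assms subset] coset_eq assms by simp

text \<open>By normality, \<open>r (H s) = (r H) s = (H r) s\<close>, and the last is the coset of \<open>r \<otimes> s\<close>.\<close>

lemma bij_betw_two_sided_mult:
  assumes r: "r \<in> carrier G" and s: "s \<in> carrier G"
  shows "bij_betw (\<lambda>n. r \<otimes> n \<otimes> s) H ((H #> r) <#> (H #> s))"
proof -
  have "r <# H = H #> r"
    using coset_eq r by simp
  then have coset: "r <# (H #> s) = (H #> r) <#> (H #> s)"
    using r s subset by (simp add: coset_assoc coset_mult_assoc rcos_sum)
  have "bij_betw ((\<lambda>x. r \<otimes> x) \<circ> (\<lambda>n. n \<otimes> s)) H (r <# (H #> s))"
    using bij_betw_r_coset[OF s] bij_betw_l_coset[OF r r_coset_subset_G[OF subset s]]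
    by (rule bij_betw_trans)
  also have "?this \<longleftrightarrow> bij_betw (\<lambda>n. r \<otimes> n \<otimes> s) H (r <# (H #> s))"
    using r s by (intro bij_betw_cong) (simp add: m_assoc)
  finally show ?thesis
    unfolding coset .
qed

text \<open>Dividing out the representative turns a coset into \<open>H\<close>, so a map on a coset may be checked in
  the coordinate \<open>n\<close> of \<open>r \<otimes> n\<close>.\<close>

lemma bij_betw_coset_coordinate:
  assumes r: "r \<in> carrier G" and k: "bij_betw k H B"
    and F: "\<And>n. n \<in> H \<Longrightarrow> F (r \<otimes> n) = k n"
  shows "bij_betw F (H #> r) B"
proof -
  have "bij_betw (F \<circ> (\<lambda>n. r \<otimes> n)) H B"
    using k F by (simp cong: bij_betw_cong)
  then show ?thesis
    using bij_betw_comp_iff[OF bij_betw_rep_l_mult[OF r]] by blast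
qed

lemma coset_lift_rep_mult:
  assumes t: "\<And>C. C \<in> rcosets H \<Longrightarrow> t C \<in> carrier G \<and> H #> t C = C"
    and C: "C \<in> rcosets H" and n: "n \<in> H"
  shows "coset_lift t \<phi> h (t C \<otimes> n) = h C n \<otimes> t (\<phi> C)"
proof -
  have r: "t C \<in> carrier G" "H #> t C = C" using t C by auto
  have "t C \<otimes> n \<in> C"
    using bij_betwE[OF bij_betw_rep_l_mult[OF r(1)]] n r(2) by auto
  then have "H #> (t C \<otimes> n) = C"
    using repr_independence[OF _ r(1) is_subgroup] r(2) by auto
  moreover have "inv (t C) \<otimes> (t C \<otimes> n) = n"
    using r(1) n mem_carrier by (simp flip: m_assoc)
  ultimately show ?thesis
    using r(1) n mem_carrier by (simp add: coset_lift_def)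
qed

lemma complete_mapping_coset_lift:
  assumes t: "\<And>C. C \<in> rcosets H \<Longrightarrow> t C \<in> carrier G \<and> H #> t C = C"
    and \<phi>: "complete_mapping (G Mod H) \<phi>"
    and h: "\<And>C. C \<in> rcosets H \<Longrightarrow> complete_mapping (G\<lparr>carrier := H\<rparr>) (h C)"
  shows "complete_mapping G (coset_lift t \<phi> h)"
proof -
  let ?F = "coset_lift t \<phi> h"
  have \<phi>_perm: "bij_betw \<phi> (rcosets H) (rcosets H)"
    and \<phi>_mult: "bij_betw (\<lambda>C. C <#> \<phi> C) (rcosets H) (rcosets H)"
    using \<phi> by (auto simp: complete_mapping_def FactGroup_def permutes_imp_bij)
  have h_perm: "bij_betw (h C) H H"
    and h_mult: "bij_betw (\<lambda>n. n \<otimes> h C n) H H" if "C \<in> rcosets H" for C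
    using h[OF that] by (auto simp: complete_mapping_def permutes_imp_bij)
  have F_coset: "bij_betw ?F C (\<phi> C)"
    and mult_coset: "bij_betw (\<lambda>g. g \<otimes> ?F g) C (C <#> \<phi> C)" if C: "C \<in> rcosets H" for C
  proof -
    have D: "\<phi> C \<in> rcosets H" using bij_betwE[OF \<phi>_perm] C by blast
    have r: "t C \<in> carrier G" "H #> t C = C" and s: "t (\<phi> C) \<in> carrier G" "H #> t (\<phi> C) = \<phi> C"
      using t C D by auto
    have hH: "h C n \<in> H" if "n \<in> H" for n
      using bij_betwE[OF h_perm[OF C]] that by blast
    have F: "?F (t C \<otimes> n) = h C n \<otimes> t (\<phi> C)" if "n \<in> H" for n
      by (rule coset_lift_rep_mult[OF t C that])
    have "bij_betw ((\<lambda>n. n \<otimes> t (\<phi> C)) \<circ> h C) H (\<phi> C)"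
      using bij_betw_trans[OF h_perm[OF C] bij_betw_r_coset[OF s(1)]] s(2) by simp
    from bij_betw_coset_coordinate[OF r(1) this, of ?F] F r(2)
    show "bij_betw ?F C (\<phi> C)" by simp
    have mult: "bij_betw ((\<lambda>n. t C \<otimes> n \<otimes> t (\<phi> C)) \<circ> (\<lambda>n. n \<otimes> h C n)) H (C <#> \<phi> C)"
      using bij_betw_trans[OF h_mult[OF C] bij_betw_two_sided_mult[OF r(1) s(1)]] r(2) s(2) by simp
    have "(t C \<otimes> n) \<otimes> ?F (t C \<otimes> n)
        = ((\<lambda>n. t C \<otimes> n \<otimes> t (\<phi> C)) \<circ> (\<lambda>n. n \<otimes> h C n)) n" if "n \<in> H" for n
      using that hH[OF that] F[OF that] r(1) s(1) mem_carrier by (simp add: m_assoc)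
    from bij_betw_coset_coordinate[OF r(1) mult, of "\<lambda>g. g \<otimes> ?F g", OF this] r(2)
    show "bij_betw (\<lambda>g. g \<otimes> ?F g) C (C <#> \<phi> C)" by simp
  qed
  have "bij_betw ?F (carrier G) (carrier G)"
    using \<phi>_perm F_coset by (rule bij_betw_carrier_if_bij_betw_rcosets)
  moreover have "?F x = x" if "x \<notin> carrier G" for x
    using that by (simp add: coset_lift_def)
  ultimately have "?F permutes carrier G"
    by (rule bij_imp_permutes)
  moreover have "bij_betw (\<lambda>g. g \<otimes> ?F g) (carrier G) (carrier G)"
    using \<phi>_mult mult_coset by (rule bij_betw_carrier_if_bij_betw_rcosets)
  ultimately show ?thesis
    by (simp add: complete_mapping_def)
qed

text \<open>On the coset \<open>C = t C \<otimes> H\<close> the two lifts send \<open>t C \<otimes> n\<close> to \<open>a n \<otimes> t (\<phi> C)\<close> and to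
  \<open>b n \<otimes> t (\<phi> C)\<close>, and elsewhere they agree. So the second lift is the first one after
  the permutation \<open>t C \<otimes> n \<mapsto> t C \<otimes> (inv a \<circ> b) n\<close>, which has the parity of \<open>inv a \<circ> b\<close>.\<close>

lemma evenperm_coset_lift_upd:
  assumes fin: "finite (carrier G)"
    and t: "\<And>C. C \<in> rcosets H \<Longrightarrow> t C \<in> carrier G \<and> H #> t C = C"
    and C: "C \<in> rcosets H"
    and a: "a permutes H" and b: "b permutes H"
    and perm: "coset_lift t \<phi> (h(C := a)) permutes carrier G"
  shows "evenperm (coset_lift t \<phi> (h(C := b))) \<longleftrightarrow>
    (evenperm (coset_lift t \<phi> (h(C := a))) \<longleftrightarrow> (evenperm a \<longleftrightarrow> evenperm b))"
proof -
  let ?Fa = "coset_lift t \<phi> (h(C := a))" and ?Fb = "coset_lift t \<phi> (h(C := b))"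
  define \<sigma> where "\<sigma> = map_permutation H (\<lambda>n. t C \<otimes> n) (inv_into UNIV a \<circ> b)"
  have finH: "finite H" by (rule finite_subset[OF subset fin])
  have r: "t C \<in> carrier G" "H #> t C = C" using t[OF C] by simp_all
  have bij: "bij_betw (\<lambda>n. t C \<otimes> n) H C" using bij_betw_rep_l_mult[OF r(1)] r(2) by simp
  then have inj: "inj_on (\<lambda>n. t C \<otimes> n) H" by (rule bij_betw_imp_inj_on)
  have ab: "inv_into UNIV a \<circ> b permutes H"
    by (rule permutes_compose[OF b permutes_inv[OF a]])
  have "?Fb = ?Fa \<circ> \<sigma>"
  proof
    fix x
    show "?Fb x = (?Fa \<circ> \<sigma>) x"
    proof (cases "x \<in> C")
      case True
      then obtain n where n: "n \<in> H" "x = t C \<otimes> n" using bij by (auto simp: bij_betw_def)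
      have "(inv_into UNIV a \<circ> b) n \<in> H" using ab n(1) by (simp only: permutes_in_image)
      moreover have "\<sigma> x = t C \<otimes> (inv_into UNIV a \<circ> b) n"
        unfolding \<sigma>_def n(2) by (rule map_permutation_apply[OF inj n(1)])
      ultimately show ?thesis
        using n coset_lift_rep_mult[OF t C, where \<phi> = \<phi>] permutes_inverses(1)[OF a] by simp
    next
      case False
      then have "\<sigma> x = x"
        using bij by (simp add: \<sigma>_def map_permutation_def restrict_id_def bij_betw_def)
      moreover have "H #> x \<noteq> C" if "x \<in> carrier G"
        using False rcos_self[OF that is_subgroup] by blast
      ultimately show ?thesis
        by (simp add: coset_lift_def)
    qed
  qed
  moreover have "permutation ?Fa" using fin perm by (rule permutes_imp_permutation)
  moreover have "\<sigma> permutes C"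
    using map_permutation_permutes[OF bij ab] by (simp add: \<sigma>_def)
  then have "permutation \<sigma>"
    using bij_betw_finite[OF bij] finH permutes_imp_permutation by blast
  moreover have "evenperm \<sigma> \<longleftrightarrow> evenperm (inv_into UNIV a \<circ> b)"
    unfolding \<sigma>_def by (rule evenperm_map_permutation[OF inj ab finH])
  moreover have "evenperm (inv_into UNIV a \<circ> b) \<longleftrightarrow> (evenperm a \<longleftrightarrow> evenperm b)"
    using permutes_imp_permutation[OF finH a] permutes_imp_permutation[OF finH b]
    by (simp add: evenperm_comp evenperm_inv permutation_inverse)
  ultimately show ?thesis
    by (simp add: evenperm_comp)
qed

end

theorem lemma1p1p5:
  fixes G :: "('a, 'b) monoid_scheme" and N :: "'a set"
  assumes "group G"
    and "finite (carrier G)"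
    and "normal N G"
    and "property_P (G\<lparr>carrier := N\<rparr>)"
    and "\<exists>f. complete_mapping (G Mod N) f"
  shows "property_P G"
proof -
  interpret normal N G by fact
  obtain a b where a: "complete_mapping (G\<lparr>carrier := N\<rparr>) a" "evenperm a"
    and b: "complete_mapping (G\<lparr>carrier := N\<rparr>) b" "\<not> evenperm b"
    using assms(4) by (auto simp: property_P_def)
  obtain \<phi> where \<phi>: "complete_mapping (G Mod N) \<phi>" using assms(5) by blast
  have "\<forall>C\<in>rcosets\<^bsub>G\<^esub> N. \<exists>r. r \<in> carrier G \<and> N #>\<^bsub>G\<^esub> r = C"
    by (auto simp: RCOSETS_def)
  then obtain t where t: "\<And>C. C \<in> rcosets\<^bsub>G\<^esub> N \<Longrightarrow> t C \<in> carrier G \<and> N #>\<^bsub>G\<^esub> t C = C"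
    by metis
  \<comment> \<open>Any coset could carry the change; \<open>N\<close> is the one at hand.\<close>
  let ?Fa = "coset_lift t \<phi> ((\<lambda>_. a)(N := a))" and ?Fb = "coset_lift t \<phi> ((\<lambda>_. a)(N := b))"
  have Fa: "complete_mapping G ?Fa" and Fb: "complete_mapping G ?Fb"
    using a(1) b(1) by (intro complete_mapping_coset_lift[OF t \<phi>]; simp)+
  have "evenperm ?Fb \<longleftrightarrow> (evenperm ?Fa \<longleftrightarrow> (evenperm a \<longleftrightarrow> evenperm b))"
  proof (rule evenperm_coset_lift_upd[OF assms(2) t])
    show "N \<in> rcosets\<^bsub>G\<^esub> N" by (rule subgroup_in_rcosets[OF assms(1)])
    show "a permutes N" "b permutes N"
      using a(1) b(1) by (auto simp: complete_mapping_def)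
    show "?Fa permutes carrier G"
      using Fa by (simp add: complete_mapping_def)
  qed
  then show ?thesis
    using Fa Fb a(2) b(2) unfolding property_P_def by blast
qed

end
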